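(* Let $\nu_0=\sqrt{1-\sin^2 1}$ and $\nu_1=-\dfrac{\sin 2}{1+\cos 2}$. Let $\beta_1,\beta_2>0$ be real numbers with $\nu_0(\beta_1+\beta_2\nu_1)\geq \sqrt{2}$. Let $p$ be an analytic function in $\mathbb{D}$ with $p(0)=1$ and $$1+\beta_1 zp'(z)+\beta_2 z^2p''(z)\prec z+\sqrt{1+z^2}.$$ Then $p(z)\prec 1+\sin z$.
   Context: $\mathbb{D}=\{z\in\mathbb{C}:|z|<1\}$. For functions $f,g$ analytic in $\mathbb{D}$, $f\prec g$ ($f$ is subordinate to $g$) means there is an analytic $w:\mathbb{D}\to\mathbb{C}$ with $w(0)=0$ and $|w(z)|\leq|z|$ such that $f(z)=g(w(z))$ for all $z\in\mathbb{D}$. The square root is the principal branch. Numerically $\nu_0\approx 0.540302$, $\nu_1\approx -1.55741$. *)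

theory Defs
  imports "HOL-Complex_Analysis.Complex_Analysis"
begin

(* Only meant for f and g holomorphic on the open unit disc, where the inclusion of that
   hypothesis is left to the user of the definition. The bound |w z| <= |z| keeps w z in the
   disc, so g is never evaluated outside its domain. *)
definition subordinate :: "(complex \<Rightarrow> complex) \<Rightarrow> (complex \<Rightarrow> complex) \<Rightarrow> bool"
    (infix "\<prec>\<^sub>s" 50) where
  "f \<prec>\<^sub>s g \<longleftrightarrow>
     (\<exists>w. w holomorphic_on ball 0 1 \<and> w 0 = 0 \<and>
          (\<forall>z\<in>ball 0 1. norm (w z) \<le> norm z \<and> f z = g (w z)))"

definition nu0 :: real where
  "nu0 = sqrt (1 - (sin 1)\<^sup>2)"

definition nu1 :: real where
  "nu1 = - (sin 2 / (1 + cos 2))"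

end

theory Submission
  imports Defs
begin

text \<open>
  The crescent \<open>h(D)\<close>, \<open>h(z) = z + sqrt (1 + z\<^sup>2)\<close>, lies in the disc \<open>\<bar>h - 1\<bar> < sqrt 2\<close>, so by
  Schwarz's lemma \<open>\<bar>\<beta>\<^sub>1 p' + \<beta>\<^sub>2 z p''\<bar> \<le> sqrt 2\<close>. Integrating this Euler equation along rays
  gives \<open>\<bar>p'\<bar> \<le> sqrt 2/\<beta>\<^sub>1\<close>. The condition on \<open>\<beta>\<^sub>1\<close> and \<open>\<beta>\<^sub>2\<close> reads
  \<open>\<beta>\<^sub>1 cos 1 - \<beta>\<^sub>2 sin 1 \<ge> sqrt 2\<close> and forces \<open>\<beta>\<^sub>1 > 2\<close> because \<open>cos 1 < cos (\<pi>/4)\<close>; hence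
  \<open>\<bar>p(z) - 1\<bar> \<le> \<bar>z\<bar>/sqrt 2\<close>. On the disc of radius \<open>1/sqrt 2\<close> the derivative of \<open>arcsin\<close> is bounded
  by \<open>sqrt 2\<close>, so \<open>w = arcsin (p - 1)\<close> satisfies \<open>\<bar>w(z)\<bar> \<le> \<bar>z\<bar>\<close> and witnesses the subordination.
\<close>

lemma crescent_in_disc:
  fixes w :: complex
  assumes "norm w < 1"
  shows "norm (w + csqrt (1 + w\<^sup>2) - 1) < sqrt 2"
proof -
  \<comment> \<open>The image is cut out by \<open>\<bar>h\<^sup>2 - 1\<bar> < 2 \<bar>h\<bar>\<close> and \<open>Re h > 0\<close>; by the parallelogram law the
    former says that exactly one of \<open>\<bar>h - 1\<bar>\<^sup>2\<close>, \<open>\<bar>h + 1\<bar>\<^sup>2\<close> is less than 2.\<close>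
  define s where "s = csqrt (1 + w\<^sup>2)"
  define h where "h = w + s"
  have s2: "s\<^sup>2 = 1 + w\<^sup>2" by (simp add: s_def)
  have inv: "h * (s - w) = 1"
    using s2 by (simp add: h_def algebra_simps power2_eq_square)
  then have h0: "h \<noteq> 0" by auto
  have sm: "s - w = inverse h"
    using inv by (simp add: inverse_unique)
  have hs: "h + inverse h = 2 * s" and hw: "h - inverse h = 2 * w"
    using sm by (auto simp: h_def algebra_simps)
  have "norm (w\<^sup>2) < 1"
    using assms by (simp add: norm_power power_less_one_iff)
  then have "Re (1 + w\<^sup>2) > 0"
    using abs_Re_le_cmod[of "w\<^sup>2"] by simp
  then have "Re s > 0"
    unfolding s_def csqrt.sel by (simp add: add_nonneg_pos)
  \<comment> \<open>\<open>Re (inverse h)\<close> is \<open>Re h / (norm h)\<^sup>2\<close>, which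
    has the sign of \<open>Re h\<close>; the positive sum \<open>2 * Re s\<close> then makes
    \<open>Re h\<close> positive.\<close>
  moreover have "Re h * (1 + inverse ((norm h)\<^sup>2)) = 2 * Re s"
    using arg_cong[OF hs, of Re] by (simp add: cmod_power2 distrib_left divide_inverse)
  ultimately have "Re h * (1 + inverse ((norm h)\<^sup>2)) > 0" by simp
  then have Re_h: "Re h > 0"
    by (smt (verit) inverse_nonnegative_iff_nonnegative mult_nonpos_nonneg zero_le_power2)
  have "norm (h\<^sup>2 - 1) = norm (h * (h - inverse h))"
    using h0 by (simp add: right_diff_distrib power2_eq_square)
  also have "\<dots> < norm h * 2"
    unfolding norm_mult hw using assms h0 by simp
  finally have "norm (h - 1) * norm (h + 1) < 2 * norm h"
    by (simp flip: norm_mult add: algebra_simps power2_eq_square)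
  then have "(norm (h - 1) * norm (h + 1))\<^sup>2 < (2 * norm h)\<^sup>2"
    by (intro power_strict_mono) auto
  then have "((norm (h - 1))\<^sup>2 - 2) * ((norm (h + 1))\<^sup>2 - 2) < 0"
    by (simp add: cmod_power2 power_mult_distrib) (simp add: algebra_simps power2_eq_square)
  moreover have "(norm (h - 1))\<^sup>2 < (norm (h + 1))\<^sup>2"
    using Re_h by (simp add: cmod_power2) (simp add: algebra_simps power2_eq_square)
  ultimately have "(norm (h - 1))\<^sup>2 < 2"
    by (smt (verit) mult_nonneg_nonneg)
  then show ?thesis
    by (simp add: h_def s_def real_less_rsqrt)
qed

text \<open>Multiplied by \<open>t powr (a / b - 1) / b\<close>, the Euler expression at
  \<open>t * z\<close> is the derivative of \<open>t powr (a / b) * v (t * z)\<close> in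
  \<open>t\<close>. The resulting bound \<open>M / b * t powr (a / b - 1)\<close> integrates to
  \<open>M / a\<close> over [0, 1].\<close>

lemma norm_le_of_euler_operator_bound:
  fixes v :: "complex \<Rightarrow> complex" and a b M :: real
  assumes v: "v holomorphic_on ball 0 1" and "a > 0" "b > 0"
    and bnd: "\<And>z. z \<in> ball 0 1 \<Longrightarrow> z \<noteq> 0 \<Longrightarrow>
      norm (of_real a * v z + of_real b * z * deriv v z) \<le> M"
    and z: "z \<in> ball 0 1" "z \<noteq> 0"
  shows "norm (v z) \<le> M / a"
proof -
  define \<alpha> where "\<alpha> = a / b"
  have \<alpha>: "\<alpha> > 0" using assms by (simp add: \<alpha>_def)
  have in_ball: "of_real t * z \<in> ball 0 1" if "0 \<le> t" "t \<le> 1" for t :: real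
    using that z by (auto simp: norm_mult intro: le_less_trans[OF mult_left_le_one_le])
  \<comment> \<open>\<open>t powr (a / b)\<close> is the integrating factor of the equation along the ray through \<open>z\<close>.\<close>
  define \<phi> where "\<phi> = (\<lambda>t::real. (t powr \<alpha>) *\<^sub>R v (of_real t * z))"
  define \<phi>' where "\<phi>' = (\<lambda>t::real. (t powr \<alpha>) *\<^sub>R (z * deriv v (of_real t * z))
      + (\<alpha> * t powr (\<alpha> - 1)) *\<^sub>R v (of_real t * z))"
  define \<psi> where "\<psi> = (\<lambda>t::real. M / a * t powr \<alpha>)"
  \<comment> \<open>As \<open>\<alpha> > 0\<close>, both functions are continuous up to 0 and vanish
    there, so this compares \<open>v z\<close> with \<open>M / a\<close>.\<close>
  have "norm (\<phi> 1 - \<phi> 0) \<le> \<psi> 1 - \<psi> 0"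
  proof (rule differentiable_bound_general)
    show "continuous_on {0..1} \<phi>"
      unfolding \<phi>_def using \<alpha> in_ball
      by (intro continuous_intros continuous_on_powr'
          continuous_on_compose2[OF holomorphic_on_imp_continuous_on[OF v]]) auto
    show "continuous_on {0..1} \<psi>"
      unfolding \<psi>_def using \<alpha> by (intro continuous_intros continuous_on_powr') auto
    fix t :: real assume t: "0 < t" "t < 1"
    have "(v has_field_derivative deriv v (of_real t * z)) (at (of_real t * z))"
      using in_ball t by (intro holomorphic_derivI[OF v]) auto
    then have "((\<lambda>t. v (of_real t * z)) has_vector_derivative z * deriv v (of_real t * z)) (at t)"
      by (rule field_vector_diff_chain_at[unfolded o_def, rotated])
        (auto intro!: derivative_eq_intros)
    moreover have "((\<lambda>t. t powr \<alpha>) has_real_derivative \<alpha> * t powr (\<alpha> - 1)) (at t)"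
      using t(1) by (rule has_real_derivative_powr)
    ultimately show "(\<phi> has_vector_derivative \<phi>' t) (at t)"
      unfolding \<phi>_def \<phi>'_def by (intro has_vector_derivative_scaleR)
    show "(\<psi> has_vector_derivative (M / b * t powr (\<alpha> - 1))) (at t)"
      unfolding \<psi>_def has_real_derivative_iff_has_vector_derivative[symmetric]
      using t assms by (auto intro!: derivative_eq_intros simp: \<alpha>_def)
    have powr_eq: "t powr \<alpha> = t * t powr (\<alpha> - 1)"
      using t by (simp add: powr_mult_base)
    have a_eq: "a = \<alpha> * b" using assms by (simp add: \<alpha>_def)
    have "\<phi>' t = (t powr (\<alpha> - 1) / b) *\<^sub>R (of_real a * v (of_real t * z)
        + of_real b * (of_real t * z) * deriv v (of_real t * z))"
      using \<open>b > 0\<close> unfolding \<phi>'_def powr_eq a_eq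
      by (simp add: scaleR_conv_of_real distrib_left)
    also have "norm \<dots> \<le> t powr (\<alpha> - 1) / b * M"
      unfolding norm_scaleR using assms t z in_ball[of t]
      by (intro mult_mono bnd) auto
    finally show "norm (\<phi>' t) \<le> M / b * t powr (\<alpha> - 1)" by (simp add: mult.commute)
  qed simp
  then show ?thesis using \<alpha> by (simp add: \<phi>_def \<psi>_def)
qed

text \<open>Mean value inequality on the segment from 0 to \<open>z\<close>. The derivative is
  bounded off the origin only, the form in which the Euler estimate supplies it.\<close>

lemma norm_diff_le_of_deriv_bound:
  fixes p :: "complex \<Rightarrow> complex"
  assumes p: "p holomorphic_on ball 0 1"
    and bnd: "\<And>z. z \<in> ball 0 1 \<Longrightarrow> z \<noteq> 0 \<Longrightarrow> norm (deriv p z) \<le> c"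
    and z: "z \<in> ball 0 1"
  shows "norm (p z - p 0) \<le> c * norm z"
proof (cases "z = 0")
  case False
  have in_ball: "of_real t * z \<in> ball 0 1" if "0 \<le> t" "t \<le> 1" for t :: real
    using that z by (auto simp: norm_mult intro: le_less_trans[OF mult_left_le_one_le])
  have "norm (p (of_real 1 * z) - p (of_real 0 * z)) \<le> c * norm z * 1 - c * norm z * 0"
  proof (rule differentiable_bound_general[where f = "\<lambda>t. p (of_real t * z)"
        and \<phi> = "\<lambda>t. c * norm z * t" and \<phi>' = "\<lambda>_. c * norm z"
        and f' = "\<lambda>t. z * deriv p (of_real t * z)"])
    show "continuous_on {0..1} (\<lambda>t. p (of_real t * z))"
      using in_ball by (intro continuous_intros
          continuous_on_compose2[OF holomorphic_on_imp_continuous_on[OF p]]) auto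
    fix t :: real assume t: "0 < t" "t < 1"
    have "(p has_field_derivative deriv p (of_real t * z)) (at (of_real t * z))"
      using in_ball t by (intro holomorphic_derivI[OF p]) auto
    then show "((\<lambda>t. p (of_real t * z)) has_vector_derivative z * deriv p (of_real t * z)) (at t)"
      by (rule field_vector_diff_chain_at[unfolded o_def, rotated])
        (auto intro!: derivative_eq_intros)
    show "((\<lambda>t. c * norm z * t) has_vector_derivative c * norm z) (at t)"
      unfolding has_real_derivative_iff_has_vector_derivative[symmetric]
      by (auto intro!: derivative_eq_intros)
    show "norm (z * deriv p (of_real t * z)) \<le> c * norm z"
      using bnd[of "of_real t * z"] in_ball[of t] t False
      by (simp add: norm_mult mult.commute mult_right_mono)
  qed (auto intro!: continuous_intros)
  then show ?thesis by simp
qed simp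

text \<open>\<open>Arcsin\<close> has derivative \<open>1 / cos (Arcsin x)\<close>, and
  \<open>(cos (Arcsin x))\<^sup>2 = 1 - x\<^sup>2\<close> has modulus at least
  \<open>1 - r\<^sup>2\<close> on the convex disc \<open>cball 0 r\<close>.\<close>

lemma norm_Arcsin_le:
  assumes "norm z \<le> r" "r < 1"
  shows "norm (Arcsin z) \<le> norm z / sqrt (1 - r\<^sup>2)"
proof -
  have r0: "0 \<le> r" using assms(1) norm_ge_zero[of z] by linarith
  then have r2: "r\<^sup>2 < 1" using assms by (simp add: power_less_one_iff)
  have "norm (Arcsin z - Arcsin 0) \<le> 1 / sqrt (1 - r\<^sup>2) * norm (z - 0)"
  proof (rule field_differentiable_bound[of "cball 0 r" Arcsin "\<lambda>x. inverse (cos (Arcsin x))"])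
    fix x :: complex assume "x \<in> cball 0 r"
    then have x: "norm x \<le> r" by simp
    then have x1: "\<bar>Re x\<bar> < 1" using abs_Re_le_cmod[of x] assms by linarith
    then show "(Arcsin has_field_derivative inverse (cos (Arcsin x))) (at x within cball 0 r)"
      by (intro DERIV_subset[OF has_field_derivative_Arcsin]) auto
    have "1 - r\<^sup>2 \<le> 1 - (norm x)\<^sup>2" using x by (simp add: power_mono)
    also have "\<dots> \<le> norm (1 - x\<^sup>2)"
      using norm_triangle_ineq2[of 1 "x\<^sup>2"] by (simp add: norm_power)
    also have "1 - x\<^sup>2 = (cos (Arcsin x))\<^sup>2"
      using sin_cos_squared_add[of "Arcsin x"] by (simp add: algebra_simps)
    finally have "sqrt (1 - r\<^sup>2) \<le> norm (cos (Arcsin x))"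
      by (simp add: norm_power real_le_lsqrt)
    then show "norm (inverse (cos (Arcsin x))) \<le> 1 / sqrt (1 - r\<^sup>2)"
      using r2 by (auto simp: norm_inverse divide_inverse intro!: le_imp_inverse_le)
  qed (use assms r0 in auto)
  then show ?thesis by simp
qed

text \<open>Here \<open>nu0\<close> is \<open>cos 1\<close> and \<open>nu1\<close> is
  \<open>- tan 1\<close>, so dropping the negative \<open>\<beta>2\<close> term leaves
  \<open>sqrt 2 < cos 1 * \<beta>1\<close>.\<close>

lemma two_less_of_nu_condition:
  assumes "\<beta>2 > 0" "nu0 * (\<beta>1 + \<beta>2 * nu1) \<ge> sqrt 2"
  shows "\<beta>1 > 2"
proof -
  have pi4: "pi / 4 < 1" using pi_less_4 by simp
  have c0: "cos 1 > (0::real)" and s0: "sin 1 > (0::real)"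
    using pi_gt3 by (auto intro!: cos_gt_zero sin_gt_zero)
  have nu0: "nu0 = cos 1"
    using c0 by (simp add: nu0_def cos_squared_eq[symmetric])
  have "sin 2 = 2 * sin 1 * cos (1::real)" "1 + cos 2 = 2 * (cos (1::real))\<^sup>2"
    using sin_double[of "1::real"] cos_double_cos[of "1::real"] by auto
  then have "nu1 < 0" using c0 s0 by (simp add: nu1_def)
  then have "nu0 * (\<beta>1 + \<beta>2 * nu1) < cos 1 * \<beta>1"
    using assms c0 by (simp add: nu0 mult_pos_neg)
  then have *: "sqrt 2 < cos 1 * \<beta>1" using assms by simp
  then have "\<beta>1 > 0" using c0 by (smt (verit) mult_nonneg_nonpos real_sqrt_ge_zero)
  moreover have "cos 1 < cos (pi / 4)"
    using pi4 pi_gt3 by (intro cos_monotone_0_pi) auto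
  ultimately have "cos 1 * \<beta>1 < sqrt 2 / 2 * \<beta>1" by (simp add: cos_45)
  with * have "sqrt 2 * 2 < sqrt 2 * \<beta>1" by linarith
  then show ?thesis by simp
qed

theorem theorem2p5:
  fixes \<beta>1 \<beta>2 :: real and p :: "complex \<Rightarrow> complex"
  assumes "\<beta>1 > 0" and "\<beta>2 > 0"
    and "nu0 * (\<beta>1 + \<beta>2 * nu1) \<ge> sqrt 2"
    and "p holomorphic_on ball 0 1" and "p 0 = 1"
    and "(\<lambda>z. 1 + of_real \<beta>1 * z * deriv p z + of_real \<beta>2 * z\<^sup>2 * deriv (deriv p) z)
           \<prec>\<^sub>s (\<lambda>z. z + csqrt (1 + z\<^sup>2))"
  shows "p \<prec>\<^sub>s (\<lambda>z. 1 + sin z)"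
proof -
  note holp = \<open>p holomorphic_on ball 0 1\<close>
  have \<beta>1: "\<beta>1 > 2" using two_less_of_nu_condition assms by blast
  have holp': "deriv p holomorphic_on ball 0 1" using holp by (rule holomorphic_deriv) simp
  have holp'': "deriv (deriv p) holomorphic_on ball 0 1"
    using holp' by (rule holomorphic_deriv) simp
  obtain w where w: "\<And>z. z \<in> ball 0 1 \<Longrightarrow> norm (w z) \<le> norm z"
    and eq: "\<And>z. z \<in> ball 0 1 \<Longrightarrow>
      1 + of_real \<beta>1 * z * deriv p z + of_real \<beta>2 * z\<^sup>2 * deriv (deriv p) z
        = w z + csqrt (1 + (w z)\<^sup>2)"
    using assms(6) unfolding subordinate_def by blast
  define E where "E = (\<lambda>z. of_real \<beta>1 * deriv p z + of_real \<beta>2 * z * deriv (deriv p) z)"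
  have "norm (z * E z) < sqrt 2" if "norm z < 1" for z
  proof -
    have "z * E z = w z + csqrt (1 + (w z)\<^sup>2) - 1"
      using eq[of z] that by (simp add: E_def algebra_simps power2_eq_square)
    then show ?thesis using crescent_in_disc[of "w z"] w[of z] that by simp
  qed
  \<comment> \<open>The factor \<open>z\<close> provides the zero at the origin for Schwarz's lemma
    and is cancelled afterwards, whence \<open>z \<noteq> 0\<close> below.\<close>
  then have "norm (z * E z / of_real (sqrt 2)) \<le> norm z" if "norm z < 1" for z
    using that holp' holp'' unfolding E_def
    by (intro Schwarz_Lemma(1)) (auto intro!: holomorphic_intros simp: norm_divide)
  then have "norm z * norm (E z) \<le> norm z * sqrt 2" if "norm z < 1" for z
    using that by (simp add: norm_divide norm_mult divide_le_eq)
  then have "norm (E z) \<le> sqrt 2" if "z \<in> ball 0 1" "z \<noteq> 0" for z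
    using that by (metis mem_ball_0 mult_le_cancel_left_pos zero_less_norm_iff)
  then have "norm (deriv p z) \<le> sqrt 2 / \<beta>1" if "z \<in> ball 0 1" "z \<noteq> 0" for z
    using that holp' assms(1,2) unfolding E_def
    by (intro norm_le_of_euler_operator_bound[where b = \<beta>2]) auto
  \<comment> \<open>With \<open>r = 1 / sqrt 2\<close> the \<open>Arcsin\<close> factor
    \<open>1 / sqrt (1 - r\<^sup>2)\<close> is \<open>sqrt 2 = 1 / r\<close>, so the two constants
    cancel exactly.\<close>
  moreover have "sqrt 2 / \<beta>1 \<le> 1 / sqrt 2" using \<beta>1 by (simp add: field_simps)
  ultimately have "norm (deriv p z) \<le> 1 / sqrt 2" if "z \<in> ball 0 1" "z \<noteq> 0" for z
    using that by force
  then have q: "norm (p z - 1) \<le> norm z / sqrt 2" if "z \<in> ball 0 1" for z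
    using norm_diff_le_of_deriv_bound[OF holp _ that, of "1 / sqrt 2"] assms(5) by simp
  have q_le: "norm (p z - 1) \<le> 1 / sqrt 2" if "z \<in> ball 0 1" for z
  proof -
    have "norm z / sqrt 2 \<le> 1 / sqrt 2" using that by (simp add: divide_right_mono)
    with q[OF that] show ?thesis by linarith
  qed
  have r: "1 / sqrt 2 < (1::real)" by simp
  \<comment> \<open>This keeps \<open>p z - 1\<close> off the branch cuts of
    \<open>Arcsin\<close>.\<close>
  have q1: "\<bar>Re (p z - 1)\<bar> < 1" if "z \<in> ball 0 1" for z
    using abs_Re_le_cmod[of "p z - 1"] q_le[OF that] r by linarith
  show ?thesis
    unfolding subordinate_def
  proof (intro exI[of _ "\<lambda>z. Arcsin (p z - 1)"] conjI ballI)
    show "(\<lambda>z. Arcsin (p z - 1)) holomorphic_on ball 0 1"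
      using holp q1
      by (intro holomorphic_on_compose_gen[OF _ holomorphic_on_Arcsin,
            of _ _ "{z. \<bar>Re z\<bar> < 1}", unfolded o_def] holomorphic_intros) auto
    show "Arcsin (p 0 - 1) = 0" using assms(5) by simp
    fix z :: complex assume z: "z \<in> ball 0 1"
    show "p z = 1 + sin (Arcsin (p z - 1))" by simp
    have "norm (Arcsin (p z - 1)) \<le> norm (p z - 1) / sqrt (1 - (1 / sqrt 2)\<^sup>2)"
      by (rule norm_Arcsin_le[OF q_le[OF z] r])
    also have "\<dots> = norm (p z - 1) * sqrt 2"
      by (simp add: power_divide real_sqrt_divide)
    also have "\<dots> \<le> norm z" using q[OF z] by (simp add: field_simps)
    finally show "norm (Arcsin (p z - 1)) \<le> norm z" .
  qed
qed

end
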